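(* Let $(X,\widehat d_X)$ and $(Y,\widehat d_Y)$ be two non-Archimedean metric spaces such that every ball in $X$ and every ball in $Y$ contains at least two distinct elements. Let $P,P_1,P_2\in\mathfrak D_\flat(X,Y)$. (1) If $P$ is a Lipschitz map, then $d_a(P)=0$. (2) $$\max\{\widehat\beta_{X,Y}^{\infty}(P_1,P_2),\widehat H(P_1),\widehat H(P_2)\}=\widehat H(P_1,P_2)=\max\{\widehat\rho_s(P_1,P_2),\widehat H(P_1),\widehat H(P_2)\}.$$ (3) If for every $B\in\mathcal M_\flat(X)$ the set $\{\widehat d_Y(P_1(B^{\varepsilon}),P_2(B^{\varepsilon})):\varepsilon>0\}$ has more than one element, then $\max\{\widehat H(P_1),\widehat H(P_2)\}=\widehat H(P_1,P_2)$.
   Context: Metrics may take the value $+\infty$, and $\inf\emptyset=+\infty$. A metric $\widehat d$ is non-Archimedean if $\widehat d(x,z)\le\max\{\widehat d(x,y),\widehat d(y,z)\}$. A ball in $X$ is a set $\{x:\widehat d_X(a,x)<r\}$ or $\{x:\widehat d_X(a,x)\le r\}$ with $a\in X$, $0<r<\infty$. $\mathcal M_\flat(X)$ is the set of all balls in $X$, a non-Archimedean metric space under the Hausdorff distance $\widehat d_{X,H}$, where $d_H(A,B)=\max\{\sup_{a\in A}\operatorname{dist}(a,B),\sup_{b\in B}\operatorname{dist}(b,A)\}$ and $\operatorname{dist}(x,A)=\inf_{a\in A}d(x,a)$. For $B\in\mathcal M_\flat(X)$ and $\varepsilon>0$, $B^{\varepsilon}=\{x\in X:\operatorname{dist}(x,B)<\varepsilon\}$,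 again a ball in $X$. $\mathfrak D_\flat(X,Y)$ is the set of all maps $P:\mathcal M_\flat(X)\to Y$. $P$ is Lipschitz if there is a real $c\ge0$ with $\widehat d_Y(P(B_1),P(B_2))\le c\,\widehat d_{X,H}(B_1,B_2)$ for all $B_1,B_2\in\mathcal M_\flat(X)$. $\widehat\rho_s(P_1,P_2)=\sup_{B\in\mathcal M_\flat(X)}\widehat d_Y(P_1(B),P_2(B))$. For $\lambda>0$ and $P_1\ne P_2$, $\widehat\beta_{X,Y}^{\lambda}(P_1,P_2)$ is the infimum of all $\varepsilon>0$ such that $\widehat d_Y(P_1(B),P_2(B^{\lambda\varepsilon}))\le\varepsilon$ and $\widehat d_Y(P_2(B),P_1(B^{\lambda\varepsilon}))\le\varepsilon$ for all $B\in\mathcal M_\flat(X)$; $\widehat\beta_{X,Y}^{\lambda}(P,P)=0$. $\widehat\beta_{X,Y}^{\infty}(P_1,P_2)=\sup_{\lambda>0}\widehat\beta_{X,Y}^{\lambda}(P_1,P_2)$. For $\varepsilon>0$, $P$ is $\varepsilon$-admissible if there is $\delta>0$ such that $\widehat d_Y(P(B),P(B^{\delta}))\le\varepsilon$ for all $B\in\mathcal M_\flat(X)$; $d_a(P)=\inf\{\varepsilon>0:P\text{ is }\varepsilon\text{-admissible}\}$. Further $\widehat h_{P_1\to P_2}(B)=\sup_{\varepsilon>0}\widehat d_Y(P_1(B),P_2(B^{\varepsilon}))$, $\widehat H(P)=\sup_{B\in\mathcal M_\flat(X)}\widehat h_{P\to P}(B)$, and $\widehat H(P_1,P_2)=\sup_{B\in\mathcal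 M_\flat(X)}\max\{\widehat h_{P_1\to P_2}(B),\widehat h_{P_2\to P_1}(B)\}$. *)

theory Defs
  imports "HOL-Library.Extended_Nonnegative_Real" "HOL-Library.FuncSet"
begin

text \<open>
  Metrics may take the value infinity, so distances live in \<^typ>\<open>ennreal\<close>, where the
  supremum of the empty set is \<open>0\<close> and the infimum of the empty set is \<open>\<infinity>\<close>.
  Radii and the parameters \<open>\<epsilon>\<close>, \<open>\<delta>\<close>, \<open>lam\<close>, \<open>c\<close> are real numbers, hence finite.
\<close>

locale nonarch_metric =
  fixes X :: "'a set" and d :: "'a \<Rightarrow> 'a \<Rightarrow> ennreal"
  assumes dist_eq_zero_iff: "\<And>x y. x \<in> X \<Longrightarrow> y \<in> X \<Longrightarrow> d x y = 0 \<longleftrightarrow> x = y"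
    and dist_sym: "\<And>x y. x \<in> X \<Longrightarrow> y \<in> X \<Longrightarrow> d x y = d y x"
    and dist_ultra: "\<And>x y z. x \<in> X \<Longrightarrow> y \<in> X \<Longrightarrow> z \<in> X \<Longrightarrow> d x z \<le> max (d x y) (d y z)"

definition open_ball :: "'a set \<Rightarrow> ('a \<Rightarrow> 'a \<Rightarrow> ennreal) \<Rightarrow> 'a \<Rightarrow> real \<Rightarrow> 'a set" where
  "open_ball X d a r = {x \<in> X. d a x < ennreal r}"

definition closed_ball :: "'a set \<Rightarrow> ('a \<Rightarrow> 'a \<Rightarrow> ennreal) \<Rightarrow> 'a \<Rightarrow> real \<Rightarrow> 'a set" where
  "closed_ball X d a r = {x \<in> X. d a x \<le> ennreal r}"

definition balls :: "'a set \<Rightarrow> ('a \<Rightarrow> 'a \<Rightarrow> ennreal) \<Rightarrow> 'a set set" where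
  "balls X d = {B. \<exists>a\<in>X. \<exists>r>0. B = open_ball X d a r \<or> B = closed_ball X d a r}"

definition dist_to_set :: "('a \<Rightarrow> 'a \<Rightarrow> ennreal) \<Rightarrow> 'a \<Rightarrow> 'a set \<Rightarrow> ennreal" where
  "dist_to_set d x A = (INF a\<in>A. d x a)"

definition hausdorff_dist :: "('a \<Rightarrow> 'a \<Rightarrow> ennreal) \<Rightarrow> 'a set \<Rightarrow> 'a set \<Rightarrow> ennreal" where
  "hausdorff_dist d A B = max (SUP a\<in>A. dist_to_set d a B) (SUP b\<in>B. dist_to_set d b A)"

definition enlarge :: "'a set \<Rightarrow> ('a \<Rightarrow> 'a \<Rightarrow> ennreal) \<Rightarrow> 'a set \<Rightarrow> real \<Rightarrow> 'a set" where
  "enlarge X d B \<epsilon> = {x \<in> X. dist_to_set d x B < ennreal \<epsilon>}"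

text \<open>
  The set of all maps from the balls in \<open>X\<close> to \<open>Y\<close>. The extensional function space makes
  HOL equality of two such maps coincide with their agreement on all balls.
\<close>

definition ball_maps ::
    "'a set \<Rightarrow> ('a \<Rightarrow> 'a \<Rightarrow> ennreal) \<Rightarrow> 'b set \<Rightarrow> ('a set \<Rightarrow> 'b) set" where
  "ball_maps X dX Y = balls X dX \<rightarrow>\<^sub>E Y"

definition lipschitz_map ::
    "'a set \<Rightarrow> ('a \<Rightarrow> 'a \<Rightarrow> ennreal) \<Rightarrow> ('b \<Rightarrow> 'b \<Rightarrow> ennreal) \<Rightarrow> ('a set \<Rightarrow> 'b) \<Rightarrow> bool" where
  "lipschitz_map X dX dY P \<longleftrightarrow>
    (\<exists>c::real. c \<ge> 0 \<and>
      (\<forall>B1\<in>balls X dX. \<forall>B2\<in>balls X dX.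
        dY (P B1) (P B2) \<le> ennreal c * hausdorff_dist dX B1 B2))"

definition rho_s ::
    "'a set \<Rightarrow> ('a \<Rightarrow> 'a \<Rightarrow> ennreal) \<Rightarrow> ('b \<Rightarrow> 'b \<Rightarrow> ennreal)
      \<Rightarrow> ('a set \<Rightarrow> 'b) \<Rightarrow> ('a set \<Rightarrow> 'b) \<Rightarrow> ennreal" where
  "rho_s X dX dY P1 P2 = (SUP B\<in>balls X dX. dY (P1 B) (P2 B))"

definition beta ::
    "'a set \<Rightarrow> ('a \<Rightarrow> 'a \<Rightarrow> ennreal) \<Rightarrow> ('b \<Rightarrow> 'b \<Rightarrow> ennreal) \<Rightarrow> real
      \<Rightarrow> ('a set \<Rightarrow> 'b) \<Rightarrow> ('a set \<Rightarrow> 'b) \<Rightarrow> ennreal" where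
  "beta X dX dY lam P1 P2 =
    (if P1 = P2 then 0
     else (INF \<epsilon>\<in>{\<epsilon>::real. \<epsilon> > 0 \<and>
             (\<forall>B\<in>balls X dX.
               dY (P1 B) (P2 (enlarge X dX B (lam * \<epsilon>))) \<le> ennreal \<epsilon> \<and>
               dY (P2 B) (P1 (enlarge X dX B (lam * \<epsilon>))) \<le> ennreal \<epsilon>)}. ennreal \<epsilon>))"

definition beta_inf ::
    "'a set \<Rightarrow> ('a \<Rightarrow> 'a \<Rightarrow> ennreal) \<Rightarrow> ('b \<Rightarrow> 'b \<Rightarrow> ennreal)
      \<Rightarrow> ('a set \<Rightarrow> 'b) \<Rightarrow> ('a set \<Rightarrow> 'b) \<Rightarrow> ennreal" where
  "beta_inf X dX dY P1 P2 = (SUP lam\<in>{0<..}. beta X dX dY lam P1 P2)"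

definition admissible ::
    "'a set \<Rightarrow> ('a \<Rightarrow> 'a \<Rightarrow> ennreal) \<Rightarrow> ('b \<Rightarrow> 'b \<Rightarrow> ennreal) \<Rightarrow> real
      \<Rightarrow> ('a set \<Rightarrow> 'b) \<Rightarrow> bool" where
  "admissible X dX dY \<epsilon> P \<longleftrightarrow>
    (\<exists>\<delta>>0. \<forall>B\<in>balls X dX. dY (P B) (P (enlarge X dX B \<delta>)) \<le> ennreal \<epsilon>)"

definition d_a ::
    "'a set \<Rightarrow> ('a \<Rightarrow> 'a \<Rightarrow> ennreal) \<Rightarrow> ('b \<Rightarrow> 'b \<Rightarrow> ennreal) \<Rightarrow> ('a set \<Rightarrow> 'b) \<Rightarrow> ennreal" where
  "d_a X dX dY P = (INF \<epsilon>\<in>{\<epsilon>::real. \<epsilon> > 0 \<and> admissible X dX dY \<epsilon> P}. ennreal \<epsilon>)"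

definition h_to ::
    "'a set \<Rightarrow> ('a \<Rightarrow> 'a \<Rightarrow> ennreal) \<Rightarrow> ('b \<Rightarrow> 'b \<Rightarrow> ennreal)
      \<Rightarrow> ('a set \<Rightarrow> 'b) \<Rightarrow> ('a set \<Rightarrow> 'b) \<Rightarrow> 'a set \<Rightarrow> ennreal" where
  "h_to X dX dY P1 P2 B = (SUP \<epsilon>\<in>{0<..}. dY (P1 B) (P2 (enlarge X dX B \<epsilon>)))"

definition H_single ::
    "'a set \<Rightarrow> ('a \<Rightarrow> 'a \<Rightarrow> ennreal) \<Rightarrow> ('b \<Rightarrow> 'b \<Rightarrow> ennreal) \<Rightarrow> ('a set \<Rightarrow> 'b) \<Rightarrow> ennreal" where
  "H_single X dX dY P = (SUP B\<in>balls X dX. h_to X dX dY P P B)"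

definition H_pair ::
    "'a set \<Rightarrow> ('a \<Rightarrow> 'a \<Rightarrow> ennreal) \<Rightarrow> ('b \<Rightarrow> 'b \<Rightarrow> ennreal)
      \<Rightarrow> ('a set \<Rightarrow> 'b) \<Rightarrow> ('a set \<Rightarrow> 'b) \<Rightarrow> ennreal" where
  "H_pair X dX dY P1 P2 =
    (SUP B\<in>balls X dX. max (h_to X dX dY P1 P2 B) (h_to X dX dY P2 P1 B))"

end

theory Submission
  imports Defs
begin

text \<open>
  Two features of the ultrametric inequality carry the proof.

  First, enlarging a ball of radius \<open>r\<close> by \<open>\<epsilon> \<le> r\<close> does not change it, and enlarging it by
  \<open>\<epsilon> > r\<close> gives the open ball of radius \<open>\<epsilon>\<close> about the same centre. Hence balls stay balls
  (\<open>enlarge_in_balls\<close>), and every ball occurs among its own enlargements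
  (\<open>enlarge_fixed_ball\<close>). The second point lets the suprema over \<open>\<epsilon> > 0\<close> that define the
  \<open>H\<close>-quantities see the undisturbed value \<open>dY (P1 B) (P2 B)\<close>, so that \<open>rho_s\<close> is bounded by
  \<open>H_pair\<close>.

  Secondly, distances in \<open>Y\<close> compose by maxima. Passing through \<open>P2 B\<close> bounds
  \<open>H_pair\<close> by \<open>rho_s\<close> and the two single \<open>H\<close>-values, and it bounds each single value by
  \<open>H_pair\<close>. Passing through \<open>P2\<close> at an enlargement of \<open>B\<close> replaces \<open>rho_s\<close> by
  \<open>beta\<close> for a single value of \<open>lam\<close>, at the price of the same two \<open>H\<close>-values.
  In the other direction every real number above \<open>H_pair\<close> takes part in the infimum that defines
  \<open>beta\<close>, whatever \<open>lam\<close> is.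
  For the third claim, if \<open>dY (P1 B) (P2 B)\<close> exceeded both single \<open>H\<close>-values, moving \<open>B\<close>
  to any of its enlargements would shift both images by less than their distance,
  which in an ultrametric space leaves the distance unchanged. All the distances in the
  hypothesis would then coincide.

  The first claim holds because a ball and its \<open>\<delta>\<close>-enlargement have Hausdorff distance at most
  \<open>\<delta>\<close>.
\<close>

section \<open>Enlargements of balls\<close>

context nonarch_metric
begin

lemma dist_self: "x \<in> X \<Longrightarrow> d x x = 0"
  using dist_eq_zero_iff by blast

lemma mem_ball_center:
  assumes "a \<in> X" "r > 0"
  shows "a \<in> open_ball X d a r" "a \<in> closed_ball X d a r"
  using assms by (auto simp: open_ball_def closed_ball_def dist_self)

lemma mem_enlarge_iff: "x \<in> enlarge X d B \<epsilon> \<longleftrightarrow> x \<in> X \<and> (\<exists>b\<in>B. d x b < ennreal \<epsilon>)"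
  by (auto simp: enlarge_def dist_to_set_def INF_less_iff)

lemma balls_subset: "B \<in> balls X d \<Longrightarrow> B \<subseteq> X"
  by (auto simp: balls_def open_ball_def closed_ball_def)

text \<open>
  Every point of a ball is at distance at most the radius from the centre. So a point within
  \<open>\<epsilon>\<close> of the ball is at distance at most the maximum of \<open>\<epsilon>\<close> and the radius from the centre.
\<close>

lemma enlarge_open_ball:
  assumes a: "a \<in> X" and r: "r > 0" and e: "\<epsilon> > 0"
  shows "enlarge X d (open_ball X d a r) \<epsilon> = open_ball X d a (max r \<epsilon>)"
proof (intro set_eqI iffI)
  fix x assume "x \<in> enlarge X d (open_ball X d a r) \<epsilon>"
  then obtain b where b: "x \<in> X" "b \<in> X" "d a b < ennreal r" "d x b < ennreal \<epsilon>"
    by (auto simp: mem_enlarge_iff open_ball_def)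
  have "d a x \<le> max (d a b) (d x b)"
    using dist_ultra[OF a b(2,1)] dist_sym[OF b(1,2)] by simp
  also have "\<dots> < ennreal (max r \<epsilon>)"
    using b(3,4) ennreal_leI[of r "max r \<epsilon>"] ennreal_leI[of \<epsilon> "max r \<epsilon>"]
    by (auto intro: less_le_trans)
  finally show "x \<in> open_ball X d a (max r \<epsilon>)"
    using b(1) by (simp add: open_ball_def)
next
  fix x assume x: "x \<in> open_ball X d a (max r \<epsilon>)"
  then have xX: "x \<in> X" by (simp add: open_ball_def)
  show "x \<in> enlarge X d (open_ball X d a r) \<epsilon>"
  proof (cases "d a x < ennreal r")
    case True
    then have "x \<in> open_ball X d a r" using xX by (simp add: open_ball_def)
    moreover have "d x x < ennreal \<epsilon>" using xX e by (simp add: dist_self)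
    ultimately show ?thesis using xX by (auto simp: mem_enlarge_iff)
  next
    case False
    then have "d x a < ennreal \<epsilon>"
      using x dist_sym[OF a xX] by (auto simp: open_ball_def max_def split: if_splits)
    then show ?thesis
      using xX mem_ball_center(1)[OF a r] by (auto simp: mem_enlarge_iff)
  qed
qed

lemma enlarge_closed_ball:
  assumes a: "a \<in> X" and r: "r > 0" and e: "\<epsilon> > 0"
  shows "enlarge X d (closed_ball X d a r) \<epsilon> =
    (if \<epsilon> \<le> r then closed_ball X d a r else open_ball X d a \<epsilon>)"
proof (intro set_eqI iffI)
  fix x assume "x \<in> enlarge X d (closed_ball X d a r) \<epsilon>"
  then obtain b where b: "x \<in> X" "b \<in> X" "d a b \<le> ennreal r" "d x b < ennreal \<epsilon>"
    by (auto simp: mem_enlarge_iff closed_ball_def)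
  have le: "d a x \<le> max (d a b) (d x b)"
    using dist_ultra[OF a b(2,1)] dist_sym[OF b(1,2)] by simp
  show "x \<in> (if \<epsilon> \<le> r then closed_ball X d a r else open_ball X d a \<epsilon>)"
  proof (cases "\<epsilon> \<le> r")
    case True
    then have "d x b \<le> ennreal r"
      using b(4) ennreal_leI[OF True] by simp
    then show ?thesis using True le b(1,3)
      by (auto simp: closed_ball_def intro: order_trans)
  next
    case False
    then have "d a b < ennreal \<epsilon>"
      using e by (intro le_less_trans[OF b(3)] ennreal_lessI) auto
    then show ?thesis using False le b(1,4)
      by (auto simp: open_ball_def intro: le_less_trans)
  qed
next
  fix x assume x: "x \<in> (if \<epsilon> \<le> r then closed_ball X d a r else open_ball X d a \<epsilon>)"
  then have xX: "x \<in> X" by (auto simp: open_ball_def closed_ball_def split: if_splits)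
  show "x \<in> enlarge X d (closed_ball X d a r) \<epsilon>"
  proof (cases "\<epsilon> \<le> r")
    case True
    have "d x x < ennreal \<epsilon>" using xX e by (simp add: dist_self)
    then show ?thesis using x True xX by (auto simp: mem_enlarge_iff)
  next
    case False
    then have "d x a < ennreal \<epsilon>"
      using x dist_sym[OF a xX] by (auto simp: open_ball_def)
    then show ?thesis
      using xX mem_ball_center(2)[OF a r] by (auto simp: mem_enlarge_iff)
  qed
qed

lemma ball_in_balls:
  assumes "a \<in> X" "r > 0"
  shows "open_ball X d a r \<in> balls X d" "closed_ball X d a r \<in> balls X d"
  using assms by (auto simp: balls_def)

lemma enlarge_in_balls:
  assumes "B \<in> balls X d" "\<epsilon> > 0"
  shows "enlarge X d B \<epsilon> \<in> balls X d"
proof -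
  obtain a r where ar: "a \<in> X" "r > 0" "B = open_ball X d a r \<or> B = closed_ball X d a r"
    using assms(1) by (auto simp: balls_def)
  have "max r \<epsilon> > 0" using ar(2) by simp
  then show ?thesis
    using ar assms(2) by (auto simp: enlarge_open_ball enlarge_closed_ball ball_in_balls)
qed

text \<open>The radius of the ball serves as the witness.\<close>

lemma enlarge_fixed_ball:
  assumes "B \<in> balls X d"
  obtains \<epsilon> :: real where "\<epsilon> > 0" "enlarge X d B \<epsilon> = B"
proof -
  obtain a r where ar: "a \<in> X" "r > 0" "B = open_ball X d a r \<or> B = closed_ball X d a r"
    using assms by (auto simp: balls_def)
  then have "enlarge X d B r = B"
    using enlarge_open_ball[OF ar(1,2,2)] enlarge_closed_ball[OF ar(1,2,2)] by auto
  with ar(2) show ?thesis by (rule that)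
qed

lemma hausdorff_dist_enlarge_le:
  assumes B: "B \<in> balls X d" and e: "\<epsilon> > 0"
  shows "hausdorff_dist d B (enlarge X d B \<epsilon>) \<le> ennreal \<epsilon>"
proof -
  have "dist_to_set d a (enlarge X d B \<epsilon>) \<le> ennreal \<epsilon>" if "a \<in> B" for a
  proof -
    have aX: "a \<in> X" using that balls_subset[OF B] by auto
    then have "a \<in> enlarge X d B \<epsilon>"
      using that e by (auto simp: mem_enlarge_iff dist_self intro!: bexI[of _ a])
    then have "dist_to_set d a (enlarge X d B \<epsilon>) \<le> d a a"
      unfolding dist_to_set_def by (rule INF_lower)
    then show ?thesis by (simp add: dist_self aX)
  qed
  moreover have "dist_to_set d b B \<le> ennreal \<epsilon>" if "b \<in> enlarge X d B \<epsilon>" for b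
    using that by (simp add: enlarge_def less_imp_le)
  ultimately show ?thesis
    unfolding hausdorff_dist_def by (intro max.boundedI SUP_least)
qed

end

section \<open>Lipschitz maps\<close>

lemma d_a_eq_0_of_lipschitz:
  assumes "nonarch_metric X dX" and "lipschitz_map X dX dY P"
  shows "d_a X dX dY P = 0"
proof -
  interpret X: nonarch_metric X dX by fact
  obtain c :: real where c: "c \<ge> 0" and
    lip: "\<And>B1 B2. B1 \<in> balls X dX \<Longrightarrow> B2 \<in> balls X dX \<Longrightarrow>
      dY (P B1) (P B2) \<le> ennreal c * hausdorff_dist dX B1 B2"
    using assms(2) by (auto simp: lipschitz_map_def)
  have adm: "admissible X dX dY \<epsilon> P" if e: "\<epsilon> > 0" for \<epsilon>
    unfolding admissible_def
  proof (intro exI[of _ "\<epsilon> / (c + 1)"] conjI ballI)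
    \<comment> \<open>Dividing by \<open>c + 1\<close> instead of \<open>c\<close> covers \<open>c = 0\<close>, that is, constant maps.\<close>
    define \<delta> where "\<delta> = \<epsilon> / (c + 1)"
    have d: "\<delta> > 0" and cd: "c * \<delta> \<le> \<epsilon>"
      using e c by (auto simp: \<delta>_def field_simps)
    show "\<epsilon> / (c + 1) > 0" using d by (simp add: \<delta>_def)
    fix B assume B: "B \<in> balls X dX"
    have "dY (P B) (P (enlarge X dX B \<delta>)) \<le> ennreal c * hausdorff_dist dX B (enlarge X dX B \<delta>)"
      by (rule lip[OF B X.enlarge_in_balls[OF B d]])
    also have "\<dots> \<le> ennreal c * ennreal \<delta>"
      by (intro mult_left_mono X.hausdorff_dist_enlarge_le[OF B d]) simp
    also have "\<dots> = ennreal (c * \<delta>)" using c d by (simp add: ennreal_mult)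
    also have "\<dots> \<le> ennreal \<epsilon>" using cd by (rule ennreal_leI)
    finally show "dY (P B) (P (enlarge X dX B (\<epsilon> / (c + 1)))) \<le> ennreal \<epsilon>"
      by (simp add: \<delta>_def)
  qed
  have "d_a X dX dY P \<le> 0 + ennreal \<epsilon>" if "\<epsilon> > 0" for \<epsilon>
    unfolding d_a_def add_0_left using that adm by (intro INF_lower) simp
  then have "d_a X dX dY P \<le> 0" by (rule ennreal_le_epsilon)
  then show ?thesis by simp
qed

section \<open>Comparing two maps\<close>

lemma le_h_to: "\<epsilon> > 0 \<Longrightarrow> dY (P1 B) (P2 (enlarge X dX B \<epsilon>)) \<le> h_to X dX dY P1 P2 B"
  unfolding h_to_def by (rule SUP_upper) simp

lemma le_H_single:
  assumes "B \<in> balls X dX" "\<epsilon> > 0"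
  shows "dY (P B) (P (enlarge X dX B \<epsilon>)) \<le> H_single X dX dY P"
  unfolding H_single_def using assms by (intro SUP_upper2[OF assms(1)] le_h_to)

lemma le_H_pair:
  assumes "B \<in> balls X dX" "\<epsilon> > 0"
  shows "dY (P1 B) (P2 (enlarge X dX B \<epsilon>)) \<le> H_pair X dX dY P1 P2"
    and "dY (P2 B) (P1 (enlarge X dX B \<epsilon>)) \<le> H_pair X dX dY P1 P2"
  unfolding H_pair_def
  by (intro SUP_upper2[OF assms(1)] max.coboundedI1 max.coboundedI2 le_h_to assms(2))+

lemma le_rho_s: "B \<in> balls X dX \<Longrightarrow> dY (P1 B) (P2 B) \<le> rho_s X dX dY P1 P2"
  unfolding rho_s_def by (rule SUP_upper)

locale two_ball_maps = X: nonarch_metric X dX + Y: nonarch_metric Y dY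
  for X :: "'a set" and dX and Y :: "'b set" and dY +
  fixes P1 P2 :: "'a set \<Rightarrow> 'b"
  assumes P1: "P1 \<in> balls X dX \<rightarrow> Y" and P2: "P2 \<in> balls X dX \<rightarrow> Y"
begin

lemma image_in_Y [simp]:
  assumes "B \<in> balls X dX"
  shows "P1 B \<in> Y" "P2 B \<in> Y"
    and "\<epsilon> > 0 \<Longrightarrow> P1 (enlarge X dX B \<epsilon>) \<in> Y" "\<epsilon> > 0 \<Longrightarrow> P2 (enlarge X dX B \<epsilon>) \<in> Y"
  using assms P1 P2 X.enlarge_in_balls by blast+

lemma rho_s_le_H_pair: "rho_s X dX dY P1 P2 \<le> H_pair X dX dY P1 P2"
  unfolding rho_s_def
proof (rule SUP_least)
  fix B assume B: "B \<in> balls X dX"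
  obtain \<epsilon> :: real where "\<epsilon> > 0" "enlarge X dX B \<epsilon> = B"
    using X.enlarge_fixed_ball[OF B] .
  then show "dY (P1 B) (P2 B) \<le> H_pair X dX dY P1 P2"
    using le_H_pair(1)[OF B, of \<epsilon> dY P1 P2] by simp
qed

text \<open>
  The value of the other map at the same ball \<open>B\<close> serves as the intermediate point, here and in
  \<open>H_pair_le\<close>. Its distance to the first map at \<open>B\<close> is one of the values of \<open>rho_s\<close>.
\<close>

lemma H_single_le_H_pair:
  "H_single X dX dY P1 \<le> H_pair X dX dY P1 P2" "H_single X dX dY P2 \<le> H_pair X dX dY P1 P2"
proof -
  have rho: "dY (P1 B) (P2 B) \<le> H_pair X dX dY P1 P2" if "B \<in> balls X dX" for B
    using le_rho_s[OF that] rho_s_le_H_pair by (rule order_trans)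
  have "dY (P1 B) (P1 (enlarge X dX B \<epsilon>)) \<le> H_pair X dX dY P1 P2
      \<and> dY (P2 B) (P2 (enlarge X dX B \<epsilon>)) \<le> H_pair X dX dY P1 P2"
    if B: "B \<in> balls X dX" and e: "\<epsilon> > 0" for B \<epsilon>
  proof
    have "dY (P1 B) (P1 (enlarge X dX B \<epsilon>))
        \<le> max (dY (P1 B) (P2 B)) (dY (P2 B) (P1 (enlarge X dX B \<epsilon>)))"
      using B e by (intro Y.dist_ultra) auto
    also have "\<dots> \<le> H_pair X dX dY P1 P2"
      using rho[OF B] le_H_pair(2)[OF B e] by simp
    finally show "dY (P1 B) (P1 (enlarge X dX B \<epsilon>)) \<le> H_pair X dX dY P1 P2" .
    have "dY (P2 B) (P2 (enlarge X dX B \<epsilon>))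
        \<le> max (dY (P2 B) (P1 B)) (dY (P1 B) (P2 (enlarge X dX B \<epsilon>)))"
      using B e by (intro Y.dist_ultra) auto
    also have "\<dots> \<le> H_pair X dX dY P1 P2"
      using rho[OF B] le_H_pair(1)[OF B e] Y.dist_sym[of "P1 B" "P2 B"] B by simp
    finally show "dY (P2 B) (P2 (enlarge X dX B \<epsilon>)) \<le> H_pair X dX dY P1 P2" .
  qed
  then show "H_single X dX dY P1 \<le> H_pair X dX dY P1 P2"
    "H_single X dX dY P2 \<le> H_pair X dX dY P1 P2"
    unfolding H_single_def h_to_def by (auto intro!: SUP_least)
qed

lemma H_pair_le:
  "H_pair X dX dY P1 P2
    \<le> max (rho_s X dX dY P1 P2) (max (H_single X dX dY P1) (H_single X dX dY P2))"
    (is "_ \<le> ?M")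
proof -
  have "dY (P1 B) (P2 (enlarge X dX B \<epsilon>)) \<le> ?M \<and> dY (P2 B) (P1 (enlarge X dX B \<epsilon>)) \<le> ?M"
    if B: "B \<in> balls X dX" and e: "\<epsilon> > 0" for B \<epsilon>
  proof
    have "dY (P1 B) (P2 (enlarge X dX B \<epsilon>))
        \<le> max (dY (P1 B) (P2 B)) (dY (P2 B) (P2 (enlarge X dX B \<epsilon>)))"
      using B e by (intro Y.dist_ultra) auto
    also have "\<dots> \<le> ?M"
      using le_rho_s[OF B, of dY P1 P2] le_H_single[OF B e, of dY P2]
      by (simp add: max.coboundedI1 max.coboundedI2)
    finally show "dY (P1 B) (P2 (enlarge X dX B \<epsilon>)) \<le> ?M" .
    have "dY (P2 B) (P1 (enlarge X dX B \<epsilon>))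
        \<le> max (dY (P1 B) (P2 B)) (dY (P1 B) (P1 (enlarge X dX B \<epsilon>)))"
      using B e Y.dist_ultra[of "P2 B" "P1 B" "P1 (enlarge X dX B \<epsilon>)"]
        Y.dist_sym[of "P1 B" "P2 B"] by auto
    also have "\<dots> \<le> ?M"
      using le_rho_s[OF B, of dY P1 P2] le_H_single[OF B e, of dY P1]
      by (simp add: max.coboundedI1 max.coboundedI2)
    finally show "dY (P2 B) (P1 (enlarge X dX B \<epsilon>)) \<le> ?M" .
  qed
  then show ?thesis
    unfolding H_pair_def h_to_def by (intro SUP_least max.boundedI) auto
qed

lemma H_pair_eq_max_rho_s:
  "H_pair X dX dY P1 P2
    = max (rho_s X dX dY P1 P2) (max (H_single X dX dY P1) (H_single X dX dY P2))"
  using H_pair_le rho_s_le_H_pair H_single_le_H_pair by (intro antisym max.boundedI)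

lemma beta_inf_le_H_pair: "beta_inf X dX dY P1 P2 \<le> H_pair X dX dY P1 P2"
  unfolding beta_inf_def
proof (rule SUP_least)
  fix lam :: real assume "lam \<in> {0<..}"
  then have lam: "lam > 0" by simp
  show "beta X dX dY lam P1 P2 \<le> H_pair X dX dY P1 P2"
  proof (cases "H_pair X dX dY P1 P2")
    case (real h)
    have "beta X dX dY lam P1 P2 \<le> ennreal h + ennreal e" if "e > 0" for e
    proof (cases "P1 = P2")
      case False
      \<comment> \<open>Adding \<open>e\<close> keeps the radius positive when \<open>H_pair\<close> vanishes.\<close>
      have pos: "h + e > 0" "lam * (h + e) > 0" using that real(1) lam by auto
      have "ennreal h \<le> ennreal (h + e)" using that by (intro ennreal_leI) simp
      then have "dY (P1 B) (P2 (enlarge X dX B (lam * (h + e)))) \<le> ennreal (h + e)"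
        "dY (P2 B) (P1 (enlarge X dX B (lam * (h + e)))) \<le> ennreal (h + e)"
        if "B \<in> balls X dX" for B
        using le_H_pair[OF that pos(2), where dY = dY and ?P1.0 = P1 and ?P2.0 = P2]
        unfolding real(2) by auto
      then have "beta X dX dY lam P1 P2 \<le> ennreal (h + e)"
        unfolding beta_def using False pos(1) by (auto intro!: INF_lower)
      then show ?thesis using that real(1) by simp
    qed (simp add: beta_def)
    then show ?thesis unfolding real(2) by (rule ennreal_le_epsilon)
  qed simp
qed

text \<open>
  Only the single value \<open>lam = 1\<close> of the supremum \<open>beta_inf\<close> is used. Any other positive value
  would serve, because enlargements of every size are controlled by \<open>H_single\<close>.
\<close>

lemma rho_s_le_max_beta_inf:
  "rho_s X dX dY P1 P2 \<le> max (beta_inf X dX dY P1 P2) (H_single X dX dY P2)"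
proof -
  have "rho_s X dX dY P1 P2 \<le> max (beta X dX dY 1 P1 P2) (H_single X dX dY P2)"
    unfolding rho_s_def
  proof (rule SUP_least)
    fix B assume B: "B \<in> balls X dX"
    show "dY (P1 B) (P2 B) \<le> max (beta X dX dY 1 P1 P2) (H_single X dX dY P2)"
    proof (cases "P1 = P2")
      case True
      then show ?thesis using B Y.dist_self[of "P1 B"] by simp
    next
      case False
      show ?thesis
      proof (rule ccontr)
        assume "\<not> ?thesis"
        then have lt: "beta X dX dY 1 P1 P2 < dY (P1 B) (P2 B)"
          "H_single X dX dY P2 < dY (P1 B) (P2 B)" by (auto simp: not_le)
        obtain \<epsilon> :: real where e: "\<epsilon> > 0" "ennreal \<epsilon> < dY (P1 B) (P2 B)"
          and near: "dY (P1 B) (P2 (enlarge X dX B \<epsilon>)) \<le> ennreal \<epsilon>"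
          using lt(1) False B unfolding beta_def by (auto simp: INF_less_iff)
        have "dY (P1 B) (P2 B)
            \<le> max (dY (P1 B) (P2 (enlarge X dX B \<epsilon>))) (dY (P2 (enlarge X dX B \<epsilon>)) (P2 B))"
          using B e(1) by (intro Y.dist_ultra) auto
        also have "dY (P2 (enlarge X dX B \<epsilon>)) (P2 B) = dY (P2 B) (P2 (enlarge X dX B \<epsilon>))"
          using B e(1) by (intro Y.dist_sym) auto
        also have "max (dY (P1 B) (P2 (enlarge X dX B \<epsilon>))) \<dots> < dY (P1 B) (P2 B)"
          using near e(2) le_H_single[OF B e(1), of dY P2] lt(2) by auto
        finally show False by simp
      qed
    qed
  qed
  also have "\<dots> \<le> max (beta_inf X dX dY P1 P2) (H_single X dX dY P2)"
    unfolding beta_inf_def by (intro max.mono SUP_upper) auto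
  finally show ?thesis .
qed

lemma max_beta_inf_eq_H_pair:
  "max (beta_inf X dX dY P1 P2) (max (H_single X dX dY P1) (H_single X dX dY P2))
    = H_pair X dX dY P1 P2"
proof (rule antisym)
  show "max (beta_inf X dX dY P1 P2) (max (H_single X dX dY P1) (H_single X dX dY P2))
      \<le> H_pair X dX dY P1 P2"
    using beta_inf_le_H_pair H_single_le_H_pair by simp
  show "H_pair X dX dY P1 P2
      \<le> max (beta_inf X dX dY P1 P2) (max (H_single X dX dY P1) (H_single X dX dY P2))"
    unfolding H_pair_eq_max_rho_s
    using rho_s_le_max_beta_inf by (auto simp: le_max_iff_disj)
qed

text \<open>
  This is the isosceles principle of ultrametric spaces: moving both endpoints by less than
  their distance preserves that distance. The bound on the displacement is \<open>H_single\<close> of the two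
  maps, and it does not depend on \<open>\<epsilon>\<close>.
\<close>

lemma dist_enlarge_eq:
  assumes B: "B \<in> balls X dX" and e: "\<epsilon> > 0"
    and far: "max (H_single X dX dY P1) (H_single X dX dY P2) < dY (P1 B) (P2 B)"
  shows "dY (P1 (enlarge X dX B \<epsilon>)) (P2 (enlarge X dX B \<epsilon>)) = dY (P1 B) (P2 B)"
proof -
  define C where "C = enlarge X dX B \<epsilon>"
  have Y: "P1 B \<in> Y" "P2 B \<in> Y" "P1 C \<in> Y" "P2 C \<in> Y"
    using B e by (auto simp: C_def)
  have small: "dY (P1 B) (P1 C) < dY (P1 B) (P2 B)" "dY (P2 B) (P2 C) < dY (P1 B) (P2 B)"
    using le_H_single[OF B e, of dY P1] le_H_single[OF B e, of dY P2] far
    by (auto simp: C_def)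
  have sym: "dY (P1 C) (P1 B) = dY (P1 B) (P1 C)" "dY (P2 C) (P2 B) = dY (P2 B) (P2 C)"
    using Y Y.dist_sym by auto
  show ?thesis unfolding C_def[symmetric]
  proof (rule antisym)
    have "dY (P1 C) (P2 C) \<le> max (dY (P1 B) (P1 C)) (max (dY (P1 B) (P2 B)) (dY (P2 B) (P2 C)))"
      using Y.dist_ultra[OF Y(3,1,4)] Y.dist_ultra[OF Y(1,2,4)] sym
      by (auto simp: le_max_iff_disj)
    then show "dY (P1 C) (P2 C) \<le> dY (P1 B) (P2 B)" using small by (auto simp: le_max_iff_disj)
    have "dY (P1 B) (P2 B) \<le> max (dY (P1 B) (P1 C)) (max (dY (P1 C) (P2 C)) (dY (P2 B) (P2 C)))"
      using Y.dist_ultra[OF Y(1,3,2)] Y.dist_ultra[OF Y(3,4,2)] sym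
      by (auto simp: le_max_iff_disj)
    then show "dY (P1 B) (P2 B) \<le> dY (P1 C) (P2 C)"
      using small by (auto simp: le_max_iff_disj not_le[symmetric])
  qed
qed

lemma max_H_single_eq_H_pair:
  assumes "\<And>B. B \<in> balls X dX \<Longrightarrow> \<exists>\<epsilon>>0. \<exists>\<epsilon>'>0.
      dY (P1 (enlarge X dX B \<epsilon>)) (P2 (enlarge X dX B \<epsilon>))
        \<noteq> dY (P1 (enlarge X dX B \<epsilon>')) (P2 (enlarge X dX B \<epsilon>'))"
  shows "max (H_single X dX dY P1) (H_single X dX dY P2) = H_pair X dX dY P1 P2"
proof -
  have "dY (P1 B) (P2 B) \<le> max (H_single X dX dY P1) (H_single X dX dY P2)"
    if "B \<in> balls X dX" for B
    using assms[OF that] dist_enlarge_eq[OF that] by (metis not_le)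
  then have "rho_s X dX dY P1 P2 \<le> max (H_single X dX dY P1) (H_single X dX dY P2)"
    unfolding rho_s_def by (rule SUP_least)
  then show ?thesis unfolding H_pair_eq_max_rho_s by (simp add: max_absorb2)
qed

end

section \<open>The comparison theorem\<close>

theorem theorem4p5:
  fixes X :: "'a set" and dX :: "'a \<Rightarrow> 'a \<Rightarrow> ennreal"
    and Y :: "'b set" and dY :: "'b \<Rightarrow> 'b \<Rightarrow> ennreal"
    and P P1 P2 :: "'a set \<Rightarrow> 'b"
  assumes "nonarch_metric X dX"
    and "nonarch_metric Y dY"
    and "\<forall>B\<in>balls X dX. \<exists>x\<in>B. \<exists>y\<in>B. x \<noteq> y"
    and "\<forall>B\<in>balls Y dY. \<exists>x\<in>B. \<exists>y\<in>B. x \<noteq> y"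
    and "P \<in> ball_maps X dX Y"
    and "P1 \<in> ball_maps X dX Y"
    and "P2 \<in> ball_maps X dX Y"
  shows "(lipschitz_map X dX dY P \<longrightarrow> d_a X dX dY P = 0) \<and>
    (max (beta_inf X dX dY P1 P2) (max (H_single X dX dY P1) (H_single X dX dY P2))
        = H_pair X dX dY P1 P2 \<and>
     H_pair X dX dY P1 P2
        = max (rho_s X dX dY P1 P2) (max (H_single X dX dY P1) (H_single X dX dY P2))) \<and>
    ((\<forall>B\<in>balls X dX.
        \<exists>s \<in> {dY (P1 (enlarge X dX B \<epsilon>)) (P2 (enlarge X dX B \<epsilon>)) | \<epsilon>::real. \<epsilon> > 0}.
        \<exists>t \<in> {dY (P1 (enlarge X dX B \<epsilon>)) (P2 (enlarge X dX B \<epsilon>)) | \<epsilon>::real. \<epsilon> > 0}. s \<noteq> t)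
      \<longrightarrow> max (H_single X dX dY P1) (H_single X dX dY P2) = H_pair X dX dY P1 P2)"
proof -
  interpret XY: two_ball_maps X dX Y dY P1 P2
    using assms by (auto simp: two_ball_maps_def two_ball_maps_axioms_def ball_maps_def PiE_iff)
  show ?thesis
  proof (intro conjI impI)
    show "d_a X dX dY P = 0" if "lipschitz_map X dX dY P"
      using assms(1) that by (rule d_a_eq_0_of_lipschitz)
    show "max (beta_inf X dX dY P1 P2) (max (H_single X dX dY P1) (H_single X dX dY P2))
        = H_pair X dX dY P1 P2"
      by (rule XY.max_beta_inf_eq_H_pair)
    show "H_pair X dX dY P1 P2
        = max (rho_s X dX dY P1 P2) (max (H_single X dX dY P1) (H_single X dX dY P2))"
      by (rule XY.H_pair_eq_max_rho_s)
  next
    assume vary: "\<forall>B\<in>balls X dX.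
        \<exists>s \<in> {dY (P1 (enlarge X dX B \<epsilon>)) (P2 (enlarge X dX B \<epsilon>)) | \<epsilon>::real. \<epsilon> > 0}.
        \<exists>t \<in> {dY (P1 (enlarge X dX B \<epsilon>)) (P2 (enlarge X dX B \<epsilon>)) | \<epsilon>::real. \<epsilon> > 0}. s \<noteq> t"
    show "max (H_single X dX dY P1) (H_single X dX dY P2) = H_pair X dX dY P1 P2"
    proof (rule XY.max_H_single_eq_H_pair)
      fix B assume "B \<in> balls X dX"
      with vary show "\<exists>\<epsilon>>0. \<exists>\<epsilon>'>0.
          dY (P1 (enlarge X dX B \<epsilon>)) (P2 (enlarge X dX B \<epsilon>))
            \<noteq> dY (P1 (enlarge X dX B \<epsilon>')) (P2 (enlarge X dX B \<epsilon>'))"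
        by blast
    qed
  qed
qed

end
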